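(* Let $q$ be a prime power and for $n\geq 1$ let $p_n$ be the number of $n \times n$ projections over $\mathbf{F}_q$. Then $$1 + \sum_{n \geq 1}\frac{p_n}{\gamma_n}u^n= \left( \sum_{m\geq 0} \frac{u^m}{\gamma_m} \right)^2$$ and, for every $n\geq 1$, $$p_n = \sum_{0 \leq i \leq n} \frac{\gamma_n}{\gamma_i \gamma_{n-i}} .$$
   Context: $\mathbf{F}_q$ is the field with $q$ elements. $\gamma_n=|\mathrm{GL}_n(q)|=(q^n-1)(q^n-q)\cdots(q^n-q^{n-1})$ is the order of the group of invertible $n\times n$ matrices over $\mathbf{F}_q$, with $\gamma_0=1$. A projection is a square matrix $P$ with $P^2=P$. The generating function identity is one of formal power series in $u$. *)

theory Defs
  imports
    "Jordan_Normal_Form.Matrix"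
    "HOL-Library.Cardinality"
    "HOL-Computational_Algebra.Formal_Power_Series"
    "HOL-Computational_Algebra.Factorial_Ring"
    "HOL-Number_Theory.Prime_Powers"
begin

text \<open>
  The field with \<open>q\<close> elements is a type \<open>'a\<close> of sorts \<open>field\<close> and \<open>finite\<close> with
  \<open>CARD('a) = q\<close>; the type argument in the two counting functions selects that field.
\<close>

definition GL :: "nat \<Rightarrow> 'a::field mat set" where
  "GL n = {A \<in> carrier_mat n n. invertible_mat A}"

definition projections :: "nat \<Rightarrow> 'a::field mat set" where
  "projections n = {P \<in> carrier_mat n n. P ^\<^sub>m 2 = P}"

definition GL_order :: "'a::{field,finite} itself \<Rightarrow> nat \<Rightarrow> nat" where
  "GL_order _ n = card (GL n :: 'a mat set)"

definition num_projections :: "'a::{field,finite} itself \<Rightarrow> nat \<Rightarrow> nat" where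
  "num_projections _ n = card (projections n :: 'a mat set)"

text \<open>\<open>card\<close> is \<open>0\<close> on infinite sets, so finiteness matters here.\<close>

lemma finite_carrier_mat: "finite (carrier_mat m n :: 'a::finite mat set)"
proof (rule finite_subset)
  let ?F = "PiE ({..<m} \<times> {..<n}) (\<lambda>_. UNIV :: 'a set)"
  show "carrier_mat m n \<subseteq> (\<lambda>f. mat m n f) ` ?F"
  proof
    fix A :: "'a mat"
    assume "A \<in> carrier_mat m n"
    then have "A = mat m n (restrict (\<lambda>ij. A $$ ij) ({..<m} \<times> {..<n}))"
      by (intro eq_matI) auto
    then show "A \<in> (\<lambda>f. mat m n f) ` ?F"
      by (intro image_eqI[where x = "restrict (\<lambda>ij. A $$ ij) ({..<m} \<times> {..<n})"]) auto
  qed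
  show "finite ((\<lambda>f. mat m n f) ` ?F)"
    by (intro finite_imageI finite_PiE) auto
qed

lemma finite_GL: "finite (GL n :: 'a::{field,finite} mat set)"
  unfolding GL_def using finite_carrier_mat[of n n] by (rule rev_finite_subset) auto

lemma finite_projections: "finite (projections n :: 'a::{field,finite} mat set)"
  unfolding projections_def using finite_carrier_mat[of n n] by (rule rev_finite_subset) auto

lemma GL_order_0: "GL_order TYPE('a::{field,finite}) 0 = 1"
proof -
  have "invertible_mat (1\<^sub>m 0 :: 'a mat)"
    unfolding invertible_mat_def inverts_mat_def by (auto intro!: exI[of _ "1\<^sub>m 0"])
  moreover have "A = 1\<^sub>m 0" if "A \<in> carrier_mat 0 0" for A :: "'a mat"
    using that by (intro eq_matI) auto
  ultimately have "(GL 0 :: 'a mat set) = {1\<^sub>m 0}"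
    unfolding GL_def by auto
  then show ?thesis
    by (simp add: GL_order_def)
qed

lemma projections_iff:
  "(P :: 'a::field mat) \<in> projections n \<longleftrightarrow> P \<in> carrier_mat n n \<and> P * P = P"
  by (auto simp: projections_def numeral_2_eq_2)

end

theory Submission
  imports Defs "Jordan_Normal_Form.DL_Rank" "Jordan_Normal_Form.Schur_Decomposition"
begin

text \<open>
  The group \<open>GL n\<close> acts on the \<open>n \<times> n\<close> matrices by conjugation, and the projections are counted
  orbit by orbit.

  A projection \<open>P\<close> splits the space as the direct sum of its image, on which it is the identity,
  and its kernel.  Hence it is similar to \<open>diag_proj r k = diag(1, ..., 1, 0, ..., 0)\<close> with \<open>r\<close>
  ones and \<open>k = n - r\<close> zeros (\<open>idem_similar_diag_proj\<close>).  The characteristic polynomial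
  \<open>(X - 1) ^ r * X ^ k\<close> shows that the matrices for different \<open>r\<close> are not similar
  (\<open>similar_diag_proj_unique\<close>), so the projections are the disjoint union of \<open>n + 1\<close> similarity
  classes, one for each \<open>r \<le> n\<close>.

  By the orbit-stabilizer principle (\<open>card_GL_eq_class_times_centralizer\<close>) the class of
  \<open>diag_proj r k\<close> has \<open>\<gamma> n\<close> elements divided by the number of invertible matrices commuting with
  \<open>diag_proj r k\<close>.  These must preserve both summands, so they are the block diagonal matrices
  with blocks in \<open>GL r\<close> and \<open>GL k\<close> (\<open>centralizer_diag_proj\<close>), \<open>\<gamma> r * \<gamma> k\<close> in number.  Summing
  over \<open>r\<close> gives the formula for \<open>p n\<close>; divided by \<open>\<gamma> n\<close> it says that \<open>p n / \<gamma> n\<close> is the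
  \<open>n\<close>-th coefficient of a Cauchy square, which is the identity of power series.
\<close>

section \<open>Invertible matrices\<close>

text \<open>
  With all dimensions fixed to \<open>n\<close>, the simplifier can discharge the carrier conditions of nested
  products; in the general rules the inner dimension is left undetermined.
\<close>

lemmas square_mult = assoc_mult_mat[of _ n n _ n _ n] mult_carrier_mat[of _ n n _ n] for n

lemma GL_iff_inverse:
  fixes A :: "'a::field mat"
  shows "A \<in> GL n \<longleftrightarrow>
    A \<in> carrier_mat n n \<and> (\<exists>B \<in> carrier_mat n n. A * B = 1\<^sub>m n \<and> B * A = 1\<^sub>m n)"
proof
  assume "A \<in> GL n"
  then obtain B where A: "A \<in> carrier_mat n n"
    and AB: "A * B = 1\<^sub>m n" and BA: "B * A = 1\<^sub>m (dim_row B)"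
    by (auto simp: GL_def invertible_mat_def inverts_mat_def)
  have "dim_col B = n"
    using arg_cong[OF AB, of dim_col] by simp
  moreover have "dim_row B = n"
    using arg_cong[OF BA, of dim_col] A by simp
  ultimately show "A \<in> carrier_mat n n \<and>
      (\<exists>B \<in> carrier_mat n n. A * B = 1\<^sub>m n \<and> B * A = 1\<^sub>m n)"
    using A AB BA by auto
qed (auto simp: GL_def invertible_mat_def inverts_mat_def)

lemma GL_iff_det:
  fixes A :: "'a::field mat"
  shows "A \<in> GL n \<longleftrightarrow> A \<in> carrier_mat n n \<and> det A \<noteq> 0"
proof
  assume "A \<in> GL n"
  then obtain B where A: "A \<in> carrier_mat n n" "B \<in> carrier_mat n n" "A * B = 1\<^sub>m n"
    by (auto simp: GL_iff_inverse)
  then have "det A * det B = 1"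
    by (metis det_mult det_one)
  then show "A \<in> carrier_mat n n \<and> det A \<noteq> 0"
    using A by auto
next
  assume "A \<in> carrier_mat n n \<and> det A \<noteq> 0"
  then show "A \<in> GL n"
    using det_non_zero_imp_unit[of A n "()"]
    by (auto simp: GL_iff_inverse Units_def ring_mat_def)
qed

lemma GL_mult: "g \<in> GL n \<Longrightarrow> h \<in> GL n \<Longrightarrow> g * h \<in> (GL n :: 'a::field mat set)"
  by (auto simp: GL_iff_det det_mult)

text \<open>
  A nonzero vector extends to a basis, and a matrix whose columns form a basis has full rank.
\<close>

lemma GL_with_first_column:
  fixes v :: "'a::field vec"
  assumes v: "v \<in> carrier_vec n" "v \<noteq> 0\<^sub>v n"
  obtains G where "G \<in> GL n" "col G 0 = v"
proof -
  interpret vec_space "TYPE('a)" n .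
  let ?b = "basis_completion v"
  note b = basis_completion[OF v]
  let ?G = "mat_of_cols n ?b"
  have G: "?G \<in> carrier_mat n n"
    using b(6) by (metis mat_of_cols_carrier(1))
  have cols: "cols ?G = ?b"
    using b(2) by simp
  have "rank ?G = n"
    using lin_indpt_full_rank[OF G] b(4,5) cols by simp
  then have "?G \<in> GL n"
    using det_rank_iff[OF G] G by (simp add: GL_iff_det)
  moreover have "n > 0"
  proof (rule ccontr)
    assume "\<not> n > 0"
    then have "v = 0\<^sub>v n" using v by (intro eq_vecI) auto
    with v show False by simp
  qed
  then have "?b \<noteq> []" "0 < length ?b"
    using b(6) by auto
  then have "col ?G 0 = v"
    using b(2,7) by (metis col_mat_of_cols hd_conv_nth nth_mem subsetD)
  ultimately show ?thesis
    using that by blast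
qed

section \<open>The size of a similarity class\<close>

text \<open>
  Stating similarity as \<open>P * g = g * A\<close> avoids inverses: the matrices \<open>g\<close> that solve this equation
  for a given \<open>P\<close> are the conjugators counted below.
\<close>

lemma similar_mat_iff_GL:
  fixes A :: "'a::field mat"
  assumes A: "A \<in> carrier_mat n n"
  shows "similar_mat P A \<longleftrightarrow> P \<in> carrier_mat n n \<and> (\<exists>g \<in> GL n. P * g = g * A)"
proof
  assume "similar_mat P A"
  then obtain m g h where *: "{P, A, g, h} \<subseteq> carrier_mat m m"
      "g * h = 1\<^sub>m m" "h * g = 1\<^sub>m m" "P = g * A * h"
    by (meson similar_matD)
  with A have [simp]: "m = n"
    by auto
  have "P * g = g * A * (h * g)"
    unfolding *(4) using *(1) by (simp add: square_mult[where n = n])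
  then have "P * g = g * A"
    unfolding *(3) using *(1) A by simp
  moreover have "g \<in> GL n"
    using *(1-3) unfolding GL_iff_inverse by auto
  ultimately show "P \<in> carrier_mat n n \<and> (\<exists>g \<in> GL n. P * g = g * A)"
    using *(1) by auto
next
  assume "P \<in> carrier_mat n n \<and> (\<exists>g \<in> GL n. P * g = g * A)"
  then obtain g h where *: "P \<in> carrier_mat n n" "g \<in> carrier_mat n n" "h \<in> carrier_mat n n"
      "P * g = g * A" "g * h = 1\<^sub>m n" "h * g = 1\<^sub>m n"
    by (auto simp: GL_iff_inverse)
  have "P = P * (g * h)"
    using * by simp
  also have "\<dots> = g * A * h"
    unfolding *(4)[symmetric] using *(1-3) by simp
  finally show "similar_mat P A"
    using * A by (intro similar_matI[of _ _ g h n]) auto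
qed

lemma GL_cancel_right:
  fixes A :: "'a::field mat"
  assumes "g \<in> GL n" "A \<in> carrier_mat m n" "B \<in> carrier_mat m n" "A * g = B * g"
  shows "A = B"
proof -
  from assms obtain h where h: "g \<in> carrier_mat n n" "h \<in> carrier_mat n n" "g * h = 1\<^sub>m n"
    by (auto simp: GL_iff_inverse)
  have "A * (g * h) = B * (g * h)"
    using assms(2-4) h(1,2) by (simp del: assoc_mult_mat flip: assoc_mult_mat[of _ m n _ n _ n])
  then show ?thesis
    using assms h by simp
qed

text \<open>
  Sending \<open>g\<close> to \<open>g A g\<^sup>-\<^sup>1\<close> maps \<open>GL n\<close> onto the similarity class of \<open>A\<close>.  The fibre over \<open>P\<close>
  is the set \<open>F P\<close> of solutions of \<open>P * g = g * A\<close>, and it is a left translate of the centralizer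
  of \<open>A\<close>, so all fibres have the size of the centralizer.
\<close>

lemma card_GL_eq_class_times_centralizer:
  fixes A :: "'a::{field,finite} mat"
  assumes A: "A \<in> carrier_mat n n"
  shows "card (GL n :: 'a mat set) =
    card {P. similar_mat P A} * card {g \<in> GL n. g * A = A * g}"
proof -
  define C where "C = {P. similar_mat P A}"
  define F where "F P = {g \<in> GL n. P * g = g * A}" for P
  let ?Z = "{g \<in> GL n. g * A = A * g}"
  have C_carrier: "C \<subseteq> carrier_mat n n"
    unfolding C_def using A by (auto simp: similar_mat_iff_GL)
  then have fin_C: "finite C"
    using finite_carrier_mat finite_subset by blast
  have fin_F: "finite (F P)" for P
    unfolding F_def using finite_GL[of n, where 'a = 'a] by simp
  have GL_eq: "GL n = (\<Union>P\<in>C. F P)"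
  proof
    show "GL n \<subseteq> (\<Union>P\<in>C. F P)"
    proof
      fix g :: "'a mat" assume g: "g \<in> GL n"
      then obtain h where h: "g \<in> carrier_mat n n" "h \<in> carrier_mat n n" "h * g = 1\<^sub>m n"
        by (auto simp: GL_iff_inverse)
      have "g * A * h * g = g * A"
        using h A by (simp add: square_mult[where n = n])
      then have "g \<in> F (g * A * h)" "g * A * h \<in> C"
        using g h A by (auto simp: F_def C_def similar_mat_iff_GL)
      then show "g \<in> (\<Union>P\<in>C. F P)"
        by blast
    qed
  qed (auto simp: F_def)
  have disj: "F P \<inter> F Q = {}" if "P \<in> C" "Q \<in> C" "P \<noteq> Q" for P Q
  proof -
    have False if "g \<in> F P" "g \<in> F Q" for g
      using that \<open>P \<in> C\<close> \<open>Q \<in> C\<close> \<open>P \<noteq> Q\<close> C_carrier GL_cancel_right[of g n P n Q]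
      unfolding F_def by (metis (mono_tags, lifting) mem_Collect_eq subsetD)
    then show ?thesis
      by blast
  qed
  have card_F: "card (F P) = card ?Z" if "P \<in> C" for P
  proof -
    from that obtain g where P: "P \<in> carrier_mat n n" and g: "g \<in> GL n" and Pg: "P * g = g * A"
      unfolding C_def using A by (auto simp: similar_mat_iff_GL)
    then obtain h where h: "g \<in> carrier_mat n n" "h \<in> carrier_mat n n" "g * h = 1\<^sub>m n" "h * g = 1\<^sub>m n"
      by (auto simp: GL_iff_inverse)
    have hGL: "h \<in> GL n"
      using h by (auto simp: GL_iff_inverse)
    have hP: "h * P = A * h"
    proof -
      have "h * (P * g) * h = h * (g * A) * h"
        using Pg by simp
      moreover have "h * (P * g) * h = h * P * (g * h)" "h * (g * A) * h = (h * g) * A * h"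
        using P A h(1,2) g by (simp_all add: square_mult[where n = n])
      ultimately show ?thesis
        using P A h by simp
    qed
    have "bij_betw (\<lambda>z. g * z) ?Z (F P)"
    proof (rule bij_betwI[where g = "\<lambda>x. h * x"])
      show "(\<lambda>z. g * z) \<in> ?Z \<rightarrow> F P"
      proof
        fix z assume z: "z \<in> ?Z"
        then have zc: "z \<in> carrier_mat n n" by (auto simp: GL_iff_inverse)
        have "P * (g * z) = g * A * z"
          using P h zc Pg by (simp add: square_mult(2)[where n = n] del: assoc_mult_mat flip: square_mult(1)[where n = n])
        also have "\<dots> = g * z * A"
          using A h z zc by (simp add: square_mult[where n = n])
        finally show "g * z \<in> F P"
          using g z GL_mult by (auto simp: F_def)
      qed
      show "(\<lambda>x. h * x) \<in> F P \<rightarrow> ?Z"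
      proof
        fix x assume x: "x \<in> F P"
        then have xc: "x \<in> carrier_mat n n" by (auto simp: GL_iff_inverse F_def)
        have "h * x * A = h * (P * x)"
          using A h x xc by (simp add: F_def square_mult[where n = n])
        also have "\<dots> = A * (h * x)"
          using P A h xc hP by (simp add: square_mult(2)[where n = n] del: assoc_mult_mat flip: square_mult(1)[where n = n])
        finally show "h * x \<in> ?Z"
          using x hGL GL_mult by (auto simp: F_def)
      qed
    next
      fix z assume "z \<in> ?Z"
      then have "z \<in> carrier_mat n n" by (auto simp: GL_def)
      then show "h * (g * z) = z"
        using h by (simp del: assoc_mult_mat flip: assoc_mult_mat[OF h(2,1)])
    next
      fix x assume "x \<in> F P"
      then have "x \<in> carrier_mat n n" by (auto simp: F_def GL_def)
      then show "g * (h * x) = x"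
        using h by (simp del: assoc_mult_mat flip: assoc_mult_mat[OF h(1,2)])
    qed
    then show ?thesis
      by (simp add: bij_betw_same_card)
  qed
  have "card (GL n :: 'a mat set) = (\<Sum>P\<in>C. card (F P))"
    unfolding GL_eq using fin_C fin_F disj by (intro card_UN_disjoint) auto
  then show ?thesis
    using card_F by (simp add: C_def)
qed

section \<open>Diagonal projections\<close>

text \<open>
  Taking the numbers of ones and zeros as separate arguments, rather than the dimension and the
  rank, makes the dimension \<open>r + k\<close> match that of the four blocks.
\<close>

definition diag_proj :: "nat \<Rightarrow> nat \<Rightarrow> 'a::field mat" where
  "diag_proj r k = four_block_mat (1\<^sub>m r) (0\<^sub>m r k) (0\<^sub>m k r) (0\<^sub>m k k)"

lemma diag_proj_carrier [simp]: "diag_proj r k \<in> carrier_mat (r + k) (r + k)"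
  by (simp add: diag_proj_def)

lemma diag_proj_idem: "diag_proj r k * diag_proj r k = (diag_proj r k :: 'a::field mat)"
  unfolding diag_proj_def by (subst mult_four_block_mat) auto

lemma four_block_mat_eqD:
  assumes "A \<in> carrier_mat a b" "B \<in> carrier_mat a d" "C \<in> carrier_mat c b" "D \<in> carrier_mat c d"
    and "A' \<in> carrier_mat a b" "B' \<in> carrier_mat a d" "C' \<in> carrier_mat c b" "D' \<in> carrier_mat c d"
    and eq: "four_block_mat A B C D = four_block_mat A' B' C' D'"
  shows "A = A'" "B = B'" "C = C'" "D = D'"
proof -
  have *: "four_block_mat A B C D $$ (i, j) = four_block_mat A' B' C' D' $$ (i, j)" for i j
    using eq by simp
  show "A = A'"
  proof (intro eq_matI)
    fix i j assume "i < dim_row A'" "j < dim_col A'"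
    then show "A $$ (i, j) = A' $$ (i, j)" using assms(1-8) *[of i j] by auto
  qed (use assms in auto)
  show "B = B'"
  proof (intro eq_matI)
    fix i j assume "i < dim_row B'" "j < dim_col B'"
    then show "B $$ (i, j) = B' $$ (i, j)" using assms(1-8) *[of i "j + b"] by auto
  qed (use assms in auto)
  show "C = C'"
  proof (intro eq_matI)
    fix i j assume "i < dim_row C'" "j < dim_col C'"
    then show "C $$ (i, j) = C' $$ (i, j)" using assms(1-8) *[of "i + a" j] by auto
  qed (use assms in auto)
  show "D = D'"
  proof (intro eq_matI)
    fix i j assume "i < dim_row D'" "j < dim_col D'"
    then show "D $$ (i, j) = D' $$ (i, j)" using assms(1-8) *[of "i + a" "j + b"] by auto
  qed (use assms in auto)
qed

lemma four_block_diag_in_GL_iff: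
  fixes A :: "'a::field mat"
  assumes "A \<in> carrier_mat r r" "D \<in> carrier_mat k k"
  shows "four_block_mat A (0\<^sub>m r k) (0\<^sub>m k r) D \<in> GL (r + k) \<longleftrightarrow> A \<in> GL r \<and> D \<in> GL k"
  using assms by (auto simp: GL_iff_det det_four_block_mat_lower_left_zero[of A r _ k])

text \<open>
  Multiplying \<open>diag_proj r k\<close> by \<open>g\<close> on the left erases the last \<open>k\<close> columns of \<open>g\<close>, on the right it
  erases the last \<open>k\<close> rows.  The two results agree exactly when both off-diagonal blocks of \<open>g\<close>
  vanish.
\<close>

lemma centralizer_diag_proj:
  "{g \<in> GL (r + k). g * diag_proj r k = diag_proj r k * g} =
    (\<lambda>(A, D). four_block_mat A (0\<^sub>m r k) (0\<^sub>m k r) D) ` (GL r \<times> (GL k :: 'a::field mat set))"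
    (is "?Z = ?f ` _")
proof
  show "?Z \<subseteq> ?f ` (GL r \<times> GL k)"
  proof
    fix g :: "'a mat" assume g: "g \<in> ?Z"
    then have dim: "dim_row g = r + k" "dim_col g = r + k"
      by (auto simp: GL_def)
    obtain A B C D where "split_block g r r = (A, B, C, D)"
      by (metis surj_pair)
    note s = split_block[OF this dim]
    have "g * diag_proj r k = four_block_mat A (0\<^sub>m r k) C (0\<^sub>m k k)"
      unfolding s(5) diag_proj_def using s(1-4) by (subst mult_four_block_mat) auto
    moreover have "diag_proj r k * g = four_block_mat A B (0\<^sub>m k r) (0\<^sub>m k k)"
      unfolding s(5) diag_proj_def using s(1-4) by (subst mult_four_block_mat) auto
    ultimately have eq: "four_block_mat A (0\<^sub>m r k) C (0\<^sub>m k k) = four_block_mat A B (0\<^sub>m k r) (0\<^sub>m k k)"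
      using g by simp
    note BC = four_block_mat_eqD(2,3)[OF s(1) _ s(3) _ s(1) s(2) _ _ eq]
    have "g = ?f (A, D)"
      using s(5) BC by simp
    moreover from this have "(A, D) \<in> GL r \<times> GL k"
      using g s four_block_diag_in_GL_iff[OF s(1,4)] by simp
    ultimately show "g \<in> ?f ` (GL r \<times> GL k)"
      by blast
  qed
next
  show "?f ` (GL r \<times> GL k) \<subseteq> ?Z"
  proof (intro image_subsetI)
    fix AD :: "'a mat \<times> 'a mat" assume "AD \<in> GL r \<times> GL k"
    then obtain A D where AD_eq: "AD = (A, D)" and AD: "A \<in> GL r" "D \<in> GL k"
      by blast
    then have c: "A \<in> carrier_mat r r" "D \<in> carrier_mat k k"
      by (auto simp: GL_def)
    have "?f (A, D) * diag_proj r k = four_block_mat A (0\<^sub>m r k) (0\<^sub>m k r) (0\<^sub>m k k)"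
      unfolding diag_proj_def using c by (simp, subst mult_four_block_mat) auto
    moreover have "diag_proj r k * ?f (A, D) = four_block_mat A (0\<^sub>m r k) (0\<^sub>m k r) (0\<^sub>m k k)"
      unfolding diag_proj_def using c by (simp, subst mult_four_block_mat) auto
    ultimately show "?f AD \<in> ?Z"
      unfolding AD_eq using AD c four_block_diag_in_GL_iff[OF c] by simp
  qed
qed

lemma card_centralizer_diag_proj:
  "card {g \<in> GL (r + k). g * diag_proj r k = diag_proj r k * (g :: 'a::{field,finite} mat)} =
    GL_order TYPE('a) r * GL_order TYPE('a) k"
proof -
  have "inj_on (\<lambda>(A, D). four_block_mat A (0\<^sub>m r k) (0\<^sub>m k r) D) (GL r \<times> (GL k :: 'a mat set))"
  proof (intro inj_onI, clarify)
    fix A D A' D' :: "'a mat"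
    assume "A \<in> GL r" "D \<in> GL k" "A' \<in> GL r" "D' \<in> GL k"
      and eq: "four_block_mat A (0\<^sub>m r k) (0\<^sub>m k r) D = four_block_mat A' (0\<^sub>m r k) (0\<^sub>m k r) D'"
    then have c: "A \<in> carrier_mat r r" "D \<in> carrier_mat k k" "A' \<in> carrier_mat r r" "D' \<in> carrier_mat k k"
      by (auto simp: GL_def)
    show "A = A' \<and> D = D'"
      using four_block_mat_eqD(1,4)[OF c(1) _ _ c(2) c(3) _ _ c(4) eq] by simp
  qed
  then show ?thesis
    by (simp add: centralizer_diag_proj card_image card_cartesian_product GL_order_def)
qed

lemma char_poly_diag_proj:
  "char_poly (diag_proj r k :: 'a::field mat) = [:-1, 1:] ^ r * [:0, 1:] ^ k"
proof -
  have "upper_triangular (diag_proj r k :: 'a mat)"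
    by (auto simp: upper_triangular_def diag_proj_def)
  moreover have "diag_mat (diag_proj r k :: 'a mat) = replicate r 1 @ replicate k 0"
    by (intro nth_equalityI) (auto simp: diag_mat_def diag_proj_def nth_append)
  ultimately show ?thesis
    by (simp add: char_poly_upper_triangular[OF diag_proj_carrier])
qed

text \<open>
  The multiplicity of the root \<open>1\<close> of the characteristic polynomial recovers \<open>r\<close>.  The trace would
  not do, since it determines \<open>r\<close> only modulo the characteristic of the field.
\<close>

lemma similar_diag_proj_unique:
  assumes "similar_mat (diag_proj r k :: 'a::field mat) (diag_proj s l)"
  shows "r = s"
proof -
  have *: "Polynomial.order 1 (char_poly (diag_proj r k :: 'a mat)) = r" for r k
  proof -
    have "Polynomial.order 1 ([:0, 1:] ^ k :: 'a poly) = 0"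
      by (intro order_0I) simp
    then show ?thesis
      unfolding char_poly_diag_proj by (subst order_mult) (auto simp: order_power_n_n)
  qed
  show ?thesis
    using *[of r k] *[of s l] char_poly_similar[OF assms] by simp
qed

section \<open>Every projection is similar to a diagonal one\<close>

lemma similar_mat_idem:
  fixes A :: "'a::field mat"
  assumes "similar_mat A B" "B * B = B"
  shows "A * A = A"
proof -
  obtain n g h where *: "{A, B, g, h} \<subseteq> carrier_mat n n"
      "g * h = 1\<^sub>m n" "h * g = 1\<^sub>m n" "A = g * B * h"
    using similar_matD[OF assms(1)] by blast
  have "A * A = g * (B * ((h * g) * (B * h)))"
    unfolding *(4) using *(1) by (simp add: square_mult[where n = n])
  also have "\<dots> = g * ((B * B) * h)"
    unfolding *(3) using *(1) by (simp add: square_mult[where n = n] left_mult_one_mat[of _ n n])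
  also have "\<dots> = A"
    unfolding *(4) assms(2) using *(1) by (simp add: square_mult[where n = n])
  finally show ?thesis .
qed

text \<open>
  Every nonzero column \<open>v\<close> of \<open>P\<close> is fixed by \<open>P\<close>, because \<open>P * P = P\<close>.  In a basis that starts with
  \<open>v\<close> the matrix becomes block upper triangular with rows of blocks \<open>(1, w)\<close> and \<open>(0, P')\<close>.
  Idempotence of this matrix means \<open>P' * P' = P'\<close> and \<open>w * P' = 0\<close>, and the latter is what allows
  a transvection to clear \<open>w\<close>.
\<close>

lemma idem_split_off_fixed_vector:
  fixes P :: "'a::field mat"
  assumes P: "P \<in> carrier_mat (Suc n) (Suc n)" "P * P = P" and nz: "P \<noteq> 0\<^sub>m (Suc n) (Suc n)"
  obtains P' where "P' \<in> carrier_mat n n" "P' * P' = P'"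
    "similar_mat P (four_block_mat (1\<^sub>m 1) (0\<^sub>m 1 n) (0\<^sub>m n 1) P')"
proof -
  let ?N = "Suc n"
  obtain j where j: "j < ?N" "col P j \<noteq> 0\<^sub>v ?N"
  proof (rule ccontr)
    assume "\<not> thesis"
    with that have z: "\<And>j. j < ?N \<Longrightarrow> col P j = 0\<^sub>v ?N" by blast
    have "P = 0\<^sub>m ?N ?N"
    proof (intro eq_matI)
      fix i j assume "i < dim_row (0\<^sub>m ?N ?N :: 'a mat)" "j < dim_col (0\<^sub>m ?N ?N :: 'a mat)"
      then show "P $$ (i, j) = 0\<^sub>m ?N ?N $$ (i, j)"
        using arg_cong[OF z[of j], of "\<lambda>v. v $ i"] P by simp
    qed (use P in auto)
    with nz show False by simp
  qed
  define v where "v = col P j"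
  have v: "v \<in> carrier_vec ?N" "v \<noteq> 0\<^sub>v ?N"
    using j P by (auto simp: v_def)
  have Pv: "P *\<^sub>v v = v"
    using col_mult2[OF P(1) P(1) j(1)] P(2) by (simp add: v_def)
  obtain G where G: "G \<in> GL ?N" and G0: "col G 0 = v"
    using GL_with_first_column[OF v] .
  then obtain H where H: "G \<in> carrier_mat ?N ?N" "H \<in> carrier_mat ?N ?N"
      "G * H = 1\<^sub>m ?N" "H * G = 1\<^sub>m ?N"
    by (auto simp: GL_iff_inverse)
  define Q where "Q = H * P * G"
  have Q: "Q \<in> carrier_mat ?N ?N"
    using H P by (simp add: Q_def)
  have simQ: "similar_mat Q P"
    using H P Q by (intro similar_matI[of _ _ H G ?N]) (auto simp: Q_def)
  have "col Q 0 = (H * P) *\<^sub>v v"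
    unfolding Q_def using H P G0 by (subst col_mult2[of _ ?N ?N _ ?N]) auto
  also have "\<dots> = H *\<^sub>v v"
    using H P v Pv by (simp add: assoc_mult_mat_vec[of _ ?N ?N _ ?N])
  also have "\<dots> = col (H * G) 0"
    using H G0 by (subst col_mult2[of _ ?N ?N _ ?N]) auto
  finally have Q0: "col Q 0 = unit_vec ?N 0"
    using H by simp
  have Q_0: "Q $$ (i, 0) = (if i = 0 then 1 else 0)" if "i < ?N" for i
    using arg_cong[OF Q0, of "\<lambda>v. v $ i"] Q that by (auto simp: unit_vec_def)
  obtain A w C P' where "split_block Q 1 1 = (A, w, C, P')"
    by (metis surj_pair)
  note s = split_block[OF this, of n n] 
  have dims: "dim_row Q = 1 + n" "dim_col Q = 1 + n"
    using Q by auto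
  note s = s[OF dims]
  have A: "A = 1\<^sub>m 1"
    using s(1,4) Q_0[of 0] by (intro eq_matI) (auto simp: s(5))
  have C: "C = 0\<^sub>m n 1"
  proof (intro eq_matI)
    fix i j assume "i < dim_row (0\<^sub>m n 1 :: 'a mat)" "j < dim_col (0\<^sub>m n 1 :: 'a mat)"
    then show "C $$ (i, j) = 0\<^sub>m n 1 $$ (i, j)"
      using s(1-4) Q_0[of "Suc i"] by (auto simp: s(5))
  qed (use s in auto)
  note Q_eq = s(5)[unfolded A C]
  have "four_block_mat (1\<^sub>m 1) (w + w * P') (0\<^sub>m n 1) (P' * P') = Q * Q"
    unfolding Q_eq using s by (subst mult_four_block_mat) auto
  also have "Q * Q = Q"
    using similar_mat_idem[OF simQ P(2)] .
  finally have eq: "four_block_mat (1\<^sub>m 1) (w + w * P') (0\<^sub>m n 1) (P' * P') =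
      four_block_mat (1\<^sub>m 1) w (0\<^sub>m n 1) P'"
    using Q_eq by simp
  have wP: "w + w * P' = w" and PP: "P' * P' = P'"
    using four_block_mat_eqD(2,4)[OF _ _ _ _ _ _ _ _ eq, of 1 1 n n] s(2,4) by auto
  \<comment> \<open>The transvection \<open>?X\<close> conjugates \<open>Q\<close> to \<open>?D\<close>: both \<open>?X * Q\<close> and \<open>?D * ?X\<close> have the rows
    of blocks \<open>(1, w)\<close> and \<open>(0, P')\<close>.\<close>
  let ?D = "four_block_mat (1\<^sub>m 1) (0\<^sub>m 1 n) (0\<^sub>m n 1) P'"
  let ?X = "four_block_mat (1\<^sub>m 1) w (0\<^sub>m n 1) (1\<^sub>m n)"
  have X: "?X \<in> GL ?N"
    using s(2) det_four_block_mat_lower_left_zero[of "1\<^sub>m 1" 1 w n "0\<^sub>m n 1" "1\<^sub>m n :: 'a mat"]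
    by (auto simp: GL_iff_det)
  have "?D * ?X = four_block_mat (1\<^sub>m 1) w (0\<^sub>m n 1) P'"
    using s by (subst mult_four_block_mat) auto
  moreover have "?X * Q = four_block_mat (1\<^sub>m 1) (w + w * P') (0\<^sub>m n 1) P'"
    unfolding Q_eq using s by (subst mult_four_block_mat) auto
  ultimately have "?D * ?X = ?X * Q"
    using wP by simp
  moreover have "?D \<in> carrier_mat ?N ?N"
    using four_block_carrier_mat[of "1\<^sub>m 1" 1 1 P' n n] s by simp
  ultimately have "similar_mat ?D Q"
    using X Q by (auto simp: similar_mat_iff_GL)
  then have "similar_mat P ?D"
    using simQ similar_mat_sym similar_mat_trans by blast
  then show ?thesis
    using that s(4) PP by blast
qed

text \<open>
  Induction on the dimension: splitting off a fixed vector adds one leading \<open>1\<close> to the diagonal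
  form of the smaller projection, and the process stops at the zero matrix.
\<close>

lemma idem_similar_diag_proj:
  fixes P :: "'a::field mat"
  assumes "P \<in> carrier_mat n n" "P * P = P"
  shows "\<exists>r k. r + k = n \<and> similar_mat P (diag_proj r k)"
  using assms
proof (induction n arbitrary: P)
  case 0
  then have "P = diag_proj 0 0"
    by (intro eq_matI) (auto simp: diag_proj_def)
  then show ?case
    using similar_mat_refl[of "P" 0] 0 by auto
next
  case (Suc n)
  show ?case
  proof (cases "P = 0\<^sub>m (Suc n) (Suc n)")
    case True
    then have "P = diag_proj 0 (Suc n)"
      by (intro eq_matI) (auto simp: diag_proj_def)
    then show ?thesis
      using similar_mat_refl[OF Suc.prems(1)] by (metis add_0)
  next
    case False
    then obtain P' where P': "P' \<in> carrier_mat n n" "P' * P' = P'"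
      and sim: "similar_mat P (four_block_mat (1\<^sub>m 1) (0\<^sub>m 1 n) (0\<^sub>m n 1) P')"
      using idem_split_off_fixed_vector[OF Suc.prems] by blast
    obtain r k where rk: "r + k = n" "similar_mat P' (diag_proj r k)"
      using Suc.IH[OF P'] by blast
    have "similar_mat (four_block_mat (1\<^sub>m 1) (0\<^sub>m 1 n) (0\<^sub>m n 1) P')
        (four_block_mat (1\<^sub>m 1) (0\<^sub>m 1 n) (0\<^sub>m n 1) (diag_proj r k))"
      by (rule similar_mat_four_block_0_0[OF similar_mat_refl rk(2) _ P'(1)]) auto
    also have "four_block_mat (1\<^sub>m 1) (0\<^sub>m 1 n) (0\<^sub>m n 1) (diag_proj r k) = (diag_proj (Suc r) k :: 'a mat)"
      using rk(1) by (intro eq_matI) (auto simp: diag_proj_def)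
    finally show ?thesis
      using similar_mat_trans[OF sim] rk(1) by (metis add_Suc)
  qed
qed

section \<open>Counting projections\<close>

lemma projections_eq_UN_similarity_classes:
  "projections n = (\<Union>r\<in>{0..n}. {P :: 'a::field mat. similar_mat P (diag_proj r (n - r))})"
proof (intro equalityI subsetI)
  fix P :: "'a mat" assume "P \<in> projections n"
  then obtain r k where "r + k = n" "similar_mat P (diag_proj r k)"
    using idem_similar_diag_proj[of P n] by (auto simp: projections_iff)
  then show "P \<in> (\<Union>r\<in>{0..n}. {P. similar_mat P (diag_proj r (n - r))})"
    by (auto intro!: bexI[of _ r])
next
  fix P :: "'a mat" assume "P \<in> (\<Union>r\<in>{0..n}. {P. similar_mat P (diag_proj r (n - r))})"
  then obtain r where r: "r \<le> n" "similar_mat P (diag_proj r (n - r))"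
    by auto
  then show "P \<in> projections n"
    using similar_mat_idem[OF r(2) diag_proj_idem] similar_mat_iff_GL[OF diag_proj_carrier, of P r "n - r"]
    by (auto simp: projections_iff)
qed

lemma GL_order_pos: "GL_order TYPE('a::{field,finite}) n > 0"
proof -
  have "1\<^sub>m n \<in> (GL n :: 'a mat set)"
    by (simp add: GL_iff_det)
  then show ?thesis
    using finite_GL[of n, where 'a = 'a] by (auto simp: GL_order_def card_gt_0_iff)
qed

lemma num_projections_eq_sum:
  "(of_nat (num_projections TYPE('a::{field,finite}) n) :: rat) =
    (\<Sum>i = 0..n. of_nat (GL_order TYPE('a) n) /
      (of_nat (GL_order TYPE('a) i) * of_nat (GL_order TYPE('a) (n - i))))"
proof -
  define cls where "cls r = {P :: 'a mat. similar_mat P (diag_proj r (n - r))}" for r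
  have *: "projections n = (\<Union>r\<in>{0..n}. cls r)"
    unfolding cls_def by (rule projections_eq_UN_similarity_classes)
  have disj: "cls r \<inter> cls s = {}" if "r \<noteq> s" for r s
  proof (rule ccontr)
    assume "cls r \<inter> cls s \<noteq> {}"
    then have "similar_mat (diag_proj r (n - r) :: 'a mat) (diag_proj s (n - s))"
      unfolding cls_def using similar_mat_sym similar_mat_trans by blast
    with that show False
      using similar_diag_proj_unique by blast
  qed
  have "finite (cls r)" if "r \<le> n" for r
    using finite_projections[of n, where 'a = 'a] that unfolding * by auto
  then have "num_projections TYPE('a) n = (\<Sum>r = 0..n. card (cls r))"
    unfolding num_projections_def * using disj by (intro card_UN_disjoint) auto
  moreover have "(of_nat (card (cls r)) :: rat) = of_nat (GL_order TYPE('a) n) /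
      (of_nat (GL_order TYPE('a) r) * of_nat (GL_order TYPE('a) (n - r)))" if "r \<le> n" for r
  proof -
    have "GL_order TYPE('a) n =
        card (cls r) * (GL_order TYPE('a) r * GL_order TYPE('a) (n - r))"
      using card_GL_eq_class_times_centralizer[OF diag_proj_carrier[of r "n - r", where 'a = 'a]]
        card_centralizer_diag_proj[of r "n - r", where 'a = 'a] that
      by (simp add: cls_def GL_order_def)
    then show ?thesis
      using GL_order_pos[of r, where 'a = 'a] GL_order_pos[of "n - r", where 'a = 'a]
      by (simp add: field_simps)
  qed
  ultimately show ?thesis
    by simp
qed

theorem theorem14:
  fixes q :: nat and \<gamma> p :: "nat \<Rightarrow> nat"
  assumes "primepow q" and "CARD('a::{field,finite}) = q"
  defines "\<gamma> \<equiv> GL_order TYPE('a)"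
    and "p \<equiv> num_projections TYPE('a)"
  shows "1 + Abs_fps (\<lambda>n. if n \<ge> 1 then of_nat (p n) / of_nat (\<gamma> n) else 0)
           = (Abs_fps (\<lambda>m. 1 / of_nat (\<gamma> m)) :: rat fps)\<^sup>2
       \<and> (\<forall>n\<ge>1. (of_nat (p n) :: rat)
           = (\<Sum>i = 0..n. of_nat (\<gamma> n) / (of_nat (\<gamma> i) * of_nat (\<gamma> (n - i)))))"
proof -
  have sum: "(of_nat (p n) :: rat) =
      (\<Sum>i = 0..n. of_nat (\<gamma> n) / (of_nat (\<gamma> i) * of_nat (\<gamma> (n - i))))" for n
    unfolding p_def \<gamma>_def by (rule num_projections_eq_sum)
  have pos: "\<gamma> n > 0" for n
    unfolding \<gamma>_def by (rule GL_order_pos)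
  have \<gamma>0: "\<gamma> 0 = 1"
    unfolding \<gamma>_def by (rule GL_order_0)
  have quot: "(of_nat (p n) / of_nat (\<gamma> n) :: rat) =
      (\<Sum>i = 0..n. 1 / of_nat (\<gamma> i) * (1 / of_nat (\<gamma> (n - i))))" for n
    unfolding sum sum_divide_distrib using pos[of n] by (intro sum.cong) auto
  have "1 + Abs_fps (\<lambda>n. if n \<ge> 1 then of_nat (p n) / of_nat (\<gamma> n) else 0)
           = (Abs_fps (\<lambda>m. 1 / of_nat (\<gamma> m)) :: rat fps)\<^sup>2"
  proof (rule fps_ext)
    fix n
    show "fps_nth (1 + Abs_fps (\<lambda>n. if n \<ge> 1 then of_nat (p n) / of_nat (\<gamma> n) else 0)) n
           = fps_nth ((Abs_fps (\<lambda>m. 1 / of_nat (\<gamma> m)) :: rat fps)\<^sup>2) n"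
    proof (cases "n = 0")
      case True
      then show ?thesis
        by (simp add: power2_eq_square fps_mult_nth \<gamma>0)
    next
      case False
      then show ?thesis
        using quot[of n] by (simp add: power2_eq_square fps_mult_nth)
    qed
  qed
  with sum show ?thesis
    by blast
qed

end
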